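(* Let $X$ and $Y$ be Banach spaces, $A\subseteq X$ an open set, $W\subseteq X$ a finite-dimensional subspace, and $F\in C^1(A,Y)$ such that $F|_{W\cap A}$ and $(F|_{W\cap A})'$ are Lipschitz continuous. Let $Q\colon Y\to Y$ be a continuous linear finite-rank operator, with the norms on $W$ and on $Q(Y)$ induced by inner products. Let $K\subseteq W\cap A$ be a compact set and let $C>0$ be such that $$\|x_1-x_2\|_X\le 2C\,\|Q(F(x_1))-Q(F(x_2))\|_Y,\qquad x_1,x_2\in W\cap A.$$ Let $L>0$ be such that $\|F(x_1)-F(x_2)\|_Y\le L\|x_1-x_2\|_X$ for all $x_1,x_2\in K$. Let $\rho\in(0,1)$ be a radius of local convergence for the Landweber iteration associated with $Q\circ F|_{W\cap A}$ and $K$ (as defined in the context). Let $\{x^{(i)}:i\in I\}\subseteq K$ be a finite set such that $$K\subseteq\bigcup_{i\in I}B_X\Bigl(x^{(i)},\frac{\rho}{2LC\|Q\|_{Y\to Y}}\Bigr).$$ Let $x^\dag\in K$. Then: (a) there exists $i\in I$ such that $$\bigl\|Q(F(x^\dag))-Q(F(x^{(i)}))\bigr\|_Y<\frac{\rho}{2C};$$ (b) if this inequality holds for some $i\in I$, then $\|x^{(i)}-x^\dag\|_X<\rho$.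
   Context: $B_X(x,r)$ denotes the open ball in $X$ with center $x$ and radius $r$. $F\in C^1(A,Y)$ means that $F$ is continuously Fréchet differentiable on $A$. Radius of local convergence: $\rho\in(0,1)$ is such that there exist $\mu,c\in(0,1)$ with the following property. Write $G=Q\circ F|_{W\cap A}\colon W\cap A\to Q(Y)$. For every $x^\dag\in K$, with $y=G(x^\dag)$, and every $x_0\in K$ with $\|x_0-x^\dag\|_X<\rho$, the Landweber iterates $$x_{k+1}=x_k-\mu\,G'(x_k)^*\bigl(G(x_k)-y\bigr),\qquad k\in\mathbb{N},$$ converge to $x^\dag$ and satisfy $\|x_k-x^\dag\|_X\le\rho c^k$ for all $k\in\mathbb{N}$. Here $G'(x_k)^*$ is the adjoint of the linear map $G'(x_k)\colon W\to Q(Y)$ with respect to the inner products on $W$ and $Q(Y)$. *)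

theory Defs
  imports "HOL-Analysis.Analysis"
begin

definition C1_on :: "'a::real_normed_vector set \<Rightarrow> ('a \<Rightarrow> 'b::real_normed_vector) \<Rightarrow> bool" where
  "C1_on A F \<longleftrightarrow>
     (\<exists>F' :: 'a \<Rightarrow> 'a \<Rightarrow>\<^sub>L 'b.
        (\<forall>x\<in>A. (F has_derivative blinfun_apply (F' x)) (at x)) \<and> continuous_on A F')"

definition finite_dim_subspace :: "'a::real_vector set \<Rightarrow> bool" where
  "finite_dim_subspace V \<longleftrightarrow> subspace V \<and> (\<exists>B. finite B \<and> span B = V)"

(* Operator norm of the restriction of f to the subspace W; compare onorm_def. *)
definition onorm_on :: "'a::real_normed_vector set \<Rightarrow> ('a \<Rightarrow> 'b::real_normed_vector) \<Rightarrow> real" where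
  "onorm_on W f = (SUP h\<in>W. norm (f h) / norm h)"

(* The derivative at x of the restriction of F to the relatively open subset W \<inter> A of W is a
   linear map on W.  Here it is represented by a bounded linear map on the whole space, whose
   values are uniquely determined on W (and only there); all uses below are restricted to W. *)
definition restr_deriv ::
  "'a::real_normed_vector set \<Rightarrow> 'a set \<Rightarrow> ('a \<Rightarrow> 'b::real_normed_vector) \<Rightarrow> 'a \<Rightarrow> 'a \<Rightarrow> 'b" where
  "restr_deriv W A F x = frechet_derivative F (at x within W \<inter> A)"

definition restr_deriv_lipschitz ::
  "'a::real_normed_vector set \<Rightarrow> 'a set \<Rightarrow> ('a \<Rightarrow> 'b::real_normed_vector) \<Rightarrow> bool" where
  "restr_deriv_lipschitz W A F \<longleftrightarrow>
     (\<exists>M\<ge>0. \<forall>x1\<in>W \<inter> A. \<forall>x2\<in>W \<inter> A.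
        onorm_on W (\<lambda>h. restr_deriv W A F x1 h - restr_deriv W A F x2 h) \<le> M * dist x1 x2)"

definition inner_product_on :: "'a::real_vector set \<Rightarrow> ('a \<Rightarrow> 'a \<Rightarrow> real) \<Rightarrow> bool" where
  "inner_product_on V ip \<longleftrightarrow>
     (\<forall>x\<in>V. \<forall>y\<in>V. ip x y = ip y x) \<and>
     (\<forall>x\<in>V. \<forall>y\<in>V. \<forall>z\<in>V. ip (x + y) z = ip x z + ip y z) \<and>
     (\<forall>r. \<forall>x\<in>V. \<forall>y\<in>V. ip (r *\<^sub>R x) y = r * ip x y) \<and>
     (\<forall>x\<in>V. 0 \<le> ip x x) \<and>
     (\<forall>x\<in>V. ip x x = 0 \<longleftrightarrow> x = 0)"

definition induces_norm_on :: "'a::real_normed_vector set \<Rightarrow> ('a \<Rightarrow> 'a \<Rightarrow> real) \<Rightarrow> bool" where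
  "induces_norm_on V ip \<longleftrightarrow> inner_product_on V ip \<and> (\<forall>x\<in>V. norm x = sqrt (ip x x))"

(* Adjoint of a linear map T from (W, ipW) to (V, ipV), evaluated at v \<in> V: the Riesz
   representative in W of the functional w \<mapsto> ipV (T w) v. *)
definition adjoint_on ::
  "'a set \<Rightarrow> ('a \<Rightarrow> 'a \<Rightarrow> real) \<Rightarrow> ('b \<Rightarrow> 'b \<Rightarrow> real) \<Rightarrow> ('a \<Rightarrow> 'b) \<Rightarrow> 'b \<Rightarrow> 'a" where
  "adjoint_on W ipW ipV T v = (THE u. u \<in> W \<and> (\<forall>w\<in>W. ipV (T w) v = ipW w u))"

primrec landweber ::
  "'a::real_normed_vector set \<Rightarrow> 'a set \<Rightarrow> ('a \<Rightarrow> 'a \<Rightarrow> real) \<Rightarrow> ('b \<Rightarrow> 'b \<Rightarrow> real) \<Rightarrow>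
   ('a \<Rightarrow> 'b::real_normed_vector) \<Rightarrow> real \<Rightarrow> 'b \<Rightarrow> 'a \<Rightarrow> nat \<Rightarrow> 'a" where
  "landweber W A ipW ipV G \<mu> y x0 0 = x0"
| "landweber W A ipW ipV G \<mu> y x0 (Suc k) =
     (let x = landweber W A ipW ipV G \<mu> y x0 k
      in x - \<mu> *\<^sub>R adjoint_on W ipW ipV (restr_deriv W A G x) (G x - y))"

(* Since G is only considered on W \<inter> A, the iteration is well defined only as long as the
   iterates stay in W \<inter> A; this is made explicit. *)
definition local_convergence_radius ::
  "'a::real_normed_vector set \<Rightarrow> 'a set \<Rightarrow> ('a \<Rightarrow> 'a \<Rightarrow> real) \<Rightarrow> ('b \<Rightarrow> 'b \<Rightarrow> real) \<Rightarrow>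
   ('a \<Rightarrow> 'b::real_normed_vector) \<Rightarrow> 'a set \<Rightarrow> real \<Rightarrow> bool" where
  "local_convergence_radius W A ipW ipV G K \<rho> \<longleftrightarrow>
     \<rho> \<in> {0<..<1} \<and>
     (\<exists>\<mu>\<in>{0<..<1}. \<exists>c\<in>{0<..<1}.
        \<forall>xd\<in>K. \<forall>x0\<in>K. norm (x0 - xd) < \<rho> \<longrightarrow>
          (let x = landweber W A ipW ipV G \<mu> (G xd) x0 in
             (\<forall>k. x k \<in> W \<inter> A) \<and> x \<longlonglongrightarrow> xd \<and> (\<forall>k. norm (x k - xd) \<le> \<rho> * c ^ k)))"

end

theory Submission
  imports Defs
begin

text \<open>
  Both parts compare distances in \<open>K\<close> with distances of the data \<open>Q (F x)\<close>. In one direction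
  \<open>x \<mapsto> Q (F x)\<close> is Lipschitz on \<open>K\<close> with constant \<open>norm Q * L\<close>, and the radius of the covering
  balls is chosen so that this constant maps it exactly to \<open>\<rho> / (2 * C)\<close>: the centre of a ball
  containing \<open>xd\<close> therefore has data closer than \<open>\<rho> / (2 * C)\<close>. In the other direction the
  stability estimate, whose constant is \<open>2 * C\<close>, turns this tolerance on the data back into the
  distance \<open>\<rho>\<close>.
\<close>

theorem lemma4:
  fixes A W K :: "'a::banach set"
    and F :: "'a \<Rightarrow> 'b::banach"
    and Q :: "'b \<Rightarrow>\<^sub>L 'b"
    and ipW :: "'a \<Rightarrow> 'a \<Rightarrow> real"
    and ipQ :: "'b \<Rightarrow> 'b \<Rightarrow> real"
    and C L \<rho> :: real
    and I :: "'i set"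
    and xs :: "'i \<Rightarrow> 'a"
    and xd :: 'a
  assumes "open A"
    and "finite_dim_subspace W"
    and "C1_on A F"
    and "\<exists>M. M-lipschitz_on (W \<inter> A) F"
    and "restr_deriv_lipschitz W A F"
    and "finite_dim_subspace (range (blinfun_apply Q))"
    and "induces_norm_on W ipW"
    and "induces_norm_on (range (blinfun_apply Q)) ipQ"
    and "compact K" and "K \<subseteq> W \<inter> A"
    and "C > 0"
    and "\<And>x1 x2. x1 \<in> W \<inter> A \<Longrightarrow> x2 \<in> W \<inter> A \<Longrightarrow>
           norm (x1 - x2) \<le> 2 * C * norm (blinfun_apply Q (F x1) - blinfun_apply Q (F x2))"
    and "L > 0"
    and "\<And>x1 x2. x1 \<in> K \<Longrightarrow> x2 \<in> K \<Longrightarrow> norm (F x1 - F x2) \<le> L * norm (x1 - x2)"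
    and "local_convergence_radius W A ipW ipQ (blinfun_apply Q \<circ> F) K \<rho>"
    and "finite (xs ` I)" and "xs ` I \<subseteq> K"
    and "K \<subseteq> (\<Union>i\<in>I. ball (xs i) (\<rho> / (2 * L * C * norm Q)))"
    and "xd \<in> K"
  shows "(\<exists>i\<in>I. norm (blinfun_apply Q (F xd) - blinfun_apply Q (F (xs i))) < \<rho> / (2 * C)) \<and>
         (\<forall>i\<in>I. norm (blinfun_apply Q (F xd) - blinfun_apply Q (F (xs i))) < \<rho> / (2 * C) \<longrightarrow>
            norm (xs i - xd) < \<rho>)"
proof (intro conjI ballI impI)
  let ?r = "\<rho> / (2 * L * C * norm Q)"
  obtain i where i: "i \<in> I" and near: "dist (xs i) xd < ?r"
    using \<open>xd \<in> K\<close> \<open>K \<subseteq> (\<Union>i\<in>I. ball (xs i) ?r)\<close> by auto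
  have xi: "xs i \<in> K"
    using i \<open>xs ` I \<subseteq> K\<close> by auto
  \<comment> \<open>For \<open>Q = 0\<close> the radius is \<open>0\<close> by the convention on division by zero, so no ball could
      contain \<open>xd\<close>.\<close>
  have "norm Q \<noteq> 0"
  proof
    assume "norm Q = 0"
    then have "?r = 0" by simp
    with near show False
      using zero_le_dist[of "xs i" xd] by linarith
  qed
  then have Q: "norm Q > 0" by simp
  have "norm (blinfun_apply Q (F xd) - blinfun_apply Q (F (xs i))) \<le> norm Q * norm (F xd - F (xs i))"
    using norm_blinfun[of Q "F xd - F (xs i)"] by (simp add: blinfun.diff_right)
  also have "\<dots> \<le> norm Q * (L * norm (xd - xs i))"
    using assms(14)[OF \<open>xd \<in> K\<close> xi] by (simp add: mult_left_mono)
  also have "\<dots> < norm Q * (L * ?r)"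
    using near Q \<open>L > 0\<close>
    by (intro mult_strict_left_mono) (auto simp only: dist_norm norm_minus_commute)
  also have "\<dots> = \<rho> / (2 * C)"
    using Q \<open>L > 0\<close> \<open>C > 0\<close> by (simp add: field_simps)
  finally show "\<exists>i\<in>I. norm (blinfun_apply Q (F xd) - blinfun_apply Q (F (xs i))) < \<rho> / (2 * C)"
    using i by blast
next
  fix i
  assume i: "i \<in> I"
    and close: "norm (blinfun_apply Q (F xd) - blinfun_apply Q (F (xs i))) < \<rho> / (2 * C)"
  have "xs i \<in> W \<inter> A" "xd \<in> W \<inter> A"
    using i \<open>xs ` I \<subseteq> K\<close> \<open>xd \<in> K\<close> \<open>K \<subseteq> W \<inter> A\<close> by auto
  then have "norm (xs i - xd) \<le> 2 * C * norm (blinfun_apply Q (F (xs i)) - blinfun_apply Q (F xd))"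
    by (rule assms(12))
  also have "\<dots> < \<rho>"
    using close \<open>C > 0\<close> by (simp add: norm_minus_commute field_simps)
  finally show "norm (xs i - xd) < \<rho>" .
qed

end
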